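(* Let $G$ be a topological group and $A$ a topological $G$-module. (i) If $A$ is an abelian group, then $H^1(G,A)$ is the first (abelian) group cohomology in the sense of Hu, i.e. it is the group of all continuous derivations of $G$ into $A$ reduced modulo the inner derivations. (ii) If $A$ is a trivial topological $G$-module, then $H^1(G,A)=Hom_c(G,A)/\sim$, where $\alpha\sim\beta$ if there exists $a\in A$ such that $\beta(g)=a^{-1}\alpha(g)a$ for all $g\in G$. (iii) If $G$ is a connected group and $A$ is a totally disconnected group, then $H^1(G,A)=1$, i.e. $H^1(G,A)$ consists of the basepoint only.
   Context: A topological $G$-module $A$ is a topological group (not necessarily abelian) on which the topological group $G$ acts continuously on the left by group automorphisms, the action being written ${}^g a$; it is trivial if ${}^g a=a$ for all $g\in G$, $a\in A$. A continuous derivation is a continuous map $\alpha:G\to A$ with $\alpha(gh)=\alpha(g)\,{}^g\alpha(h)$ for all $g,h\in G$. Two continuous derivations $\alpha,\beta$ are cohomologous if there is $a\in A$ with $\beta(g)=a^{-1}\alpha(g)\,{}^g a$ for all $g\in G$. $H^1(G,A)$ is the set of continuous derivations modulo this equivalence relation, viewed as a pointed set with basepoint the class of the trivial derivation $g\mapsto 1$. $Hom_c(G,A)$ is the set of all continuous homomorphisms of $G$ into $A$. For abelian $A$ (written additively), an inner derivation is a map of the form $g\mapsto {}^g a-a$ with $a\in A$. Hu's first cohomology group is $\mathrm{Ker}\,\tilde\delta^1/\mathrm{Im}\,\tilde\delta^0$, where $(\tilde\delta^0 a)(g)={}^g a-a$ for $a\in A$, and $(\tilde\delta^1 f)(g,h)={}^g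 f(h)-f(gh)+f(g)$ for continuous maps $f:G\to A$. *)

theory Defs
  imports "HOL-Algebra.Coset" "HOL-Algebra.Bij" "HOL-Analysis.Abstract_Topological_Spaces"
begin

text \<open>
  Groups are HOL-Algebra records, always written multiplicatively (also when abelian), and
  topologies live on their carriers. No separation axiom is assumed.
  Functions on a carrier are taken to be \<^const>\<open>extensional\<close>, so that equality
  of functions is equality on the carrier.
\<close>

locale topological_group = group G for G (structure) +
  fixes T :: "'a topology"
  assumes topspace_eq: "topspace T = carrier G"
    and continuous_mult: "continuous_map (prod_topology T T) T (\<lambda>(x, y). x \<otimes> y)"
    and continuous_inv: "continuous_map T T (\<lambda>x. inv x)"

text \<open>Multiplication in \<^const>\<open>AutoGroup\<close> is composition, so membership in
  \<^term>\<open>hom G (AutoGroup A)\<close> says that the group acts on the left by group automorphisms.\<close>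

locale topological_module =
  G: topological_group G TG + A: topological_group A TA
  for G :: "('g, 'm) monoid_scheme" and TG :: "'g topology"
    and A :: "('a, 'n) monoid_scheme" and TA :: "'a topology" +
  fixes act :: "'g \<Rightarrow> 'a \<Rightarrow> 'a"
  assumes act_hom: "act \<in> hom G (AutoGroup A)"
    and continuous_act: "continuous_map (prod_topology TG TA) TA (\<lambda>(g, a). act g a)"

definition trivial_action ::
    "('g, 'm) monoid_scheme \<Rightarrow> ('a, 'n) monoid_scheme \<Rightarrow> ('g \<Rightarrow> 'a \<Rightarrow> 'a) \<Rightarrow> bool" where
  "trivial_action G A act \<longleftrightarrow> (\<forall>g \<in> carrier G. \<forall>a \<in> carrier A. act g a = a)"

definition totally_disconnected_space :: "'a topology \<Rightarrow> bool" where
  "totally_disconnected_space T \<longleftrightarrow> (\<forall>C \<in> connected_components_of T. \<exists>x. C = {x})"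

definition cont_derivations ::
    "('g, 'm) monoid_scheme \<Rightarrow> 'g topology \<Rightarrow> ('a, 'n) monoid_scheme \<Rightarrow> 'a topology
      \<Rightarrow> ('g \<Rightarrow> 'a \<Rightarrow> 'a) \<Rightarrow> ('g \<Rightarrow> 'a) set" where
  "cont_derivations G TG A TA act =
    {\<alpha> \<in> extensional (carrier G). continuous_map TG TA \<alpha> \<and>
      (\<forall>g \<in> carrier G. \<forall>h \<in> carrier G. \<alpha> (g \<otimes>\<^bsub>G\<^esub> h) = \<alpha> g \<otimes>\<^bsub>A\<^esub> act g (\<alpha> h))}"

definition cohomologous ::
    "('g, 'm) monoid_scheme \<Rightarrow> 'g topology \<Rightarrow> ('a, 'n) monoid_scheme \<Rightarrow> 'a topology
      \<Rightarrow> ('g \<Rightarrow> 'a \<Rightarrow> 'a) \<Rightarrow> (('g \<Rightarrow> 'a) \<times> ('g \<Rightarrow> 'a)) set" where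
  "cohomologous G TG A TA act =
    {(\<alpha>, \<beta>). \<alpha> \<in> cont_derivations G TG A TA act \<and> \<beta> \<in> cont_derivations G TG A TA act \<and>
      (\<exists>a \<in> carrier A. \<forall>g \<in> carrier G. \<beta> g = inv\<^bsub>A\<^esub> a \<otimes>\<^bsub>A\<^esub> \<alpha> g \<otimes>\<^bsub>A\<^esub> act g a)}"

definition trivial_map ::
    "('g, 'm) monoid_scheme \<Rightarrow> ('a, 'n) monoid_scheme \<Rightarrow> 'g \<Rightarrow> 'a" where
  "trivial_map G A = (\<lambda>g \<in> carrier G. \<one>\<^bsub>A\<^esub>)"

definition H1 ::
    "('g, 'm) monoid_scheme \<Rightarrow> 'g topology \<Rightarrow> ('a, 'n) monoid_scheme \<Rightarrow> 'a topology
      \<Rightarrow> ('g \<Rightarrow> 'a \<Rightarrow> 'a) \<Rightarrow> ('g \<Rightarrow> 'a) set set" where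
  "H1 G TG A TA act = cont_derivations G TG A TA act // cohomologous G TG A TA act"

definition H1_basepoint ::
    "('g, 'm) monoid_scheme \<Rightarrow> 'g topology \<Rightarrow> ('a, 'n) monoid_scheme \<Rightarrow> 'a topology
      \<Rightarrow> ('g \<Rightarrow> 'a \<Rightarrow> 'a) \<Rightarrow> ('g \<Rightarrow> 'a) set" where
  "H1_basepoint G TG A TA act = cohomologous G TG A TA act `` {trivial_map G A}"

definition Hom_c ::
    "('g, 'm) monoid_scheme \<Rightarrow> 'g topology \<Rightarrow> ('a, 'n) monoid_scheme \<Rightarrow> 'a topology
      \<Rightarrow> ('g \<Rightarrow> 'a) set" where
  "Hom_c G TG A TA = {\<alpha> \<in> hom G A. \<alpha> \<in> extensional (carrier G) \<and> continuous_map TG TA \<alpha>}"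

definition conjugate_homs ::
    "('g, 'm) monoid_scheme \<Rightarrow> 'g topology \<Rightarrow> ('a, 'n) monoid_scheme \<Rightarrow> 'a topology
      \<Rightarrow> (('g \<Rightarrow> 'a) \<times> ('g \<Rightarrow> 'a)) set" where
  "conjugate_homs G TG A TA =
    {(\<alpha>, \<beta>). \<alpha> \<in> Hom_c G TG A TA \<and> \<beta> \<in> Hom_c G TG A TA \<and>
      (\<exists>a \<in> carrier A. \<forall>g \<in> carrier G. \<beta> g = inv\<^bsub>A\<^esub> a \<otimes>\<^bsub>A\<^esub> \<alpha> g \<otimes>\<^bsub>A\<^esub> a)}"

definition inner_derivations ::
    "('g, 'm) monoid_scheme \<Rightarrow> ('a, 'n) monoid_scheme \<Rightarrow> ('g \<Rightarrow> 'a \<Rightarrow> 'a) \<Rightarrow> ('g \<Rightarrow> 'a) set" where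
  "inner_derivations G A act =
    {(\<lambda>g \<in> carrier G. act g a \<otimes>\<^bsub>A\<^esub> inv\<^bsub>A\<^esub> a) | a. a \<in> carrier A}"

text \<open>Group of continuous maps into \<open>A\<close> under pointwise multiplication; Hu's 1- and 2-cochains
  are the cases \<open>X = TG\<close> and \<open>X = prod_topology TG TG\<close>.\<close>

definition cont_maps ::
    "'x topology \<Rightarrow> ('a, 'n) monoid_scheme \<Rightarrow> 'a topology \<Rightarrow> ('x \<Rightarrow> 'a) monoid" where
  "cont_maps X A TA =
    \<lparr>carrier = {f \<in> extensional (topspace X). continuous_map X TA f},
     mult = (\<lambda>f f'. \<lambda>x \<in> topspace X. f x \<otimes>\<^bsub>A\<^esub> f' x),
     one = (\<lambda>x \<in> topspace X. \<one>\<^bsub>A\<^esub>)\<rparr>"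

definition Hu_delta0 ::
    "('g, 'm) monoid_scheme \<Rightarrow> ('a, 'n) monoid_scheme \<Rightarrow> ('g \<Rightarrow> 'a \<Rightarrow> 'a)
      \<Rightarrow> 'a \<Rightarrow> 'g \<Rightarrow> 'a" where
  "Hu_delta0 G A act a = (\<lambda>g \<in> carrier G. act g a \<otimes>\<^bsub>A\<^esub> inv\<^bsub>A\<^esub> a)"

definition Hu_delta1 ::
    "('g, 'm) monoid_scheme \<Rightarrow> ('a, 'n) monoid_scheme \<Rightarrow> ('g \<Rightarrow> 'a \<Rightarrow> 'a)
      \<Rightarrow> ('g \<Rightarrow> 'a) \<Rightarrow> 'g \<times> 'g \<Rightarrow> 'a" where
  "Hu_delta1 G A act f =
    (\<lambda>(g, h) \<in> carrier G \<times> carrier G.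
      act g (f h) \<otimes>\<^bsub>A\<^esub> inv\<^bsub>A\<^esub> (f (g \<otimes>\<^bsub>G\<^esub> h)) \<otimes>\<^bsub>A\<^esub> f g)"

definition Hu_H1 ::
    "('g, 'm) monoid_scheme \<Rightarrow> 'g topology \<Rightarrow> ('a, 'n) monoid_scheme \<Rightarrow> 'a topology
      \<Rightarrow> ('g \<Rightarrow> 'a \<Rightarrow> 'a) \<Rightarrow> ('g \<Rightarrow> 'a) set monoid" where
  "Hu_H1 G TG A TA act =
    (cont_maps TG A TA)
      \<lparr>carrier := kernel (cont_maps TG A TA) (cont_maps (prod_topology TG TG) A TA)
                    (Hu_delta1 G A act)\<rparr>
    Mod (Hu_delta0 G A act ` carrier A)"

definition derivation_group ::
    "('g, 'm) monoid_scheme \<Rightarrow> 'g topology \<Rightarrow> ('a, 'n) monoid_scheme \<Rightarrow> 'a topology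
      \<Rightarrow> ('g \<Rightarrow> 'a \<Rightarrow> 'a) \<Rightarrow> ('g \<Rightarrow> 'a) monoid" where
  "derivation_group G TG A TA act =
    (cont_maps TG A TA)\<lparr>carrier := cont_derivations G TG A TA act\<rparr>"

end

theory Submission
  imports Defs
begin

text \<open>
  If \<open>A\<close> is abelian, then \<open>a\<inverse> \<alpha>(g) \<^sup>ga = (\<^sup>ga a\<inverse>) \<alpha>(g)\<close>, so the cohomology class of \<open>\<alpha>\<close> is its coset
  modulo the inner derivations, and the derivation identity for \<open>f\<close> is the vanishing of Hu's
  \<open>\<delta>\<^sup>1 f\<close>. If \<open>G\<close> is connected, the image of a continuous derivation is connected and contains
  \<open>\<alpha>(1) = 1\<close>, so it is \<open>{1}\<close> when \<open>A\<close> is totally disconnected.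
\<close>

section \<open>Cancellation and continuity of the group operations\<close>

context group
begin

text \<open>Once \<open>m_assoc\<close> has bracketed a product to the right, \<open>x\<close> and
  \<open>inv x\<close> meet only in this shape; it serves as a rewrite rule for symmetry of
  \<open>Coh\<close> and for the coboundary computation.\<close>

lemma mult_inv_cancel_left: "x \<in> carrier G \<Longrightarrow> y \<in> carrier G \<Longrightarrow> x \<otimes> (inv x \<otimes> y) = y"
  by (simp flip: m_assoc)

end

context topological_group
begin

lemma continuous_map_mult:
  assumes "continuous_map X T f" "continuous_map X T f'"
  shows "continuous_map X T (\<lambda>x. f x \<otimes> f' x)"
proof -
  have "continuous_map X (prod_topology T T) (\<lambda>x. (f x, f' x))"
    using assms by (simp add: continuous_map_paired)
  from continuous_map_compose[OF this continuous_mult] show ?thesis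
    by (simp add: o_def)
qed

lemma continuous_map_inv:
  "continuous_map X T f \<Longrightarrow> continuous_map X T (\<lambda>x. inv (f x))"
  using continuous_map_compose[OF _ continuous_inv] by (fastforce simp: o_def)

lemma continuous_map_closed:
  "continuous_map X T f \<Longrightarrow> x \<in> topspace X \<Longrightarrow> f x \<in> carrier G"
  using topspace_eq by (auto simp: continuous_map_def)

end

section \<open>The action by continuous automorphisms\<close>

context topological_module
begin

lemma act_hom_act:
  assumes "g \<in> carrier G"
  shows "act g \<in> hom A A"
  using hom_in_carrier[OF act_hom assms] by (simp add: AutoGroup_def auto_def)

lemma group_hom_act: "g \<in> carrier G \<Longrightarrow> group_hom A A (act g)"
  by (simp add: group_hom_def group_hom_axioms_def A.group_axioms act_hom_act)

lemma act_closed: "g \<in> carrier G \<Longrightarrow> a \<in> carrier A \<Longrightarrow> act g a \<in> carrier A"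
  using act_hom_act by (rule hom_in_carrier)

lemma act_mult:
  "g \<in> carrier G \<Longrightarrow> a \<in> carrier A \<Longrightarrow> b \<in> carrier A
    \<Longrightarrow> act g (a \<otimes>\<^bsub>A\<^esub> b) = act g a \<otimes>\<^bsub>A\<^esub> act g b"
  using act_hom_act by (rule hom_mult)

lemma act_one_right: "g \<in> carrier G \<Longrightarrow> act g \<one>\<^bsub>A\<^esub> = \<one>\<^bsub>A\<^esub>"
  using group_hom_act by (rule group_hom.hom_one)

lemma act_inv:
  "g \<in> carrier G \<Longrightarrow> a \<in> carrier A \<Longrightarrow> act g (inv\<^bsub>A\<^esub> a) = inv\<^bsub>A\<^esub> (act g a)"
  using group_hom_act by (rule group_hom.hom_inv)

lemma act_act:
  assumes "g \<in> carrier G" "h \<in> carrier G" "a \<in> carrier A"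
  shows "act (g \<otimes>\<^bsub>G\<^esub> h) a = act g (act h a)"
proof -
  \<comment> \<open>The product of \<open>BijGroup\<close> is a restricted function and unfolds to
    \<open>compose\<close> only for arguments known to lie in
    \<open>Bij (carrier A)\<close>.\<close>
  have "act g \<in> Bij (carrier A)" "act h \<in> Bij (carrier A)"
    using assms hom_in_carrier[OF act_hom] by (auto simp: AutoGroup_def auto_def)
  then show ?thesis
    using hom_mult[OF act_hom assms(1,2)] assms(3)
    by (simp add: AutoGroup_def BijGroup_def compose_eq)
qed

lemma continuous_map_act:
  assumes "a \<in> carrier A"
  shows "continuous_map TG TA (\<lambda>g. act g a)"
proof -
  have "continuous_map TG (prod_topology TG TA) (\<lambda>g. (g, a))"
    using assms A.topspace_eq by (simp add: continuous_map_paired continuous_map_id[unfolded id_def])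
  from continuous_map_compose[OF this continuous_act] show ?thesis
    by (simp add: o_def)
qed

section \<open>Continuous derivations and the cohomology relation\<close>

abbreviation "Der \<equiv> cont_derivations G TG A TA act"
abbreviation "Coh \<equiv> cohomologous G TG A TA act"

text \<open>Restriction changes nothing on \<open>carrier G\<close>, the whole space of
  \<open>TG\<close>, so continuity and the derivation identity may be checked on a plain expression
  in \<open>g\<close> although members of \<open>Der\<close> are extensional.\<close>

lemma restrict_in_DerI:
  assumes "continuous_map TG TA f"
    and "\<And>g h. g \<in> carrier G \<Longrightarrow> h \<in> carrier G \<Longrightarrow> f (g \<otimes>\<^bsub>G\<^esub> h) = f g \<otimes>\<^bsub>A\<^esub> act g (f h)"
  shows "restrict f (carrier G) \<in> Der"
proof -
  have "continuous_map TG TA (restrict f (carrier G))"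
    using assms(1) by (rule continuous_map_eq) (simp add: G.topspace_eq)
  then show ?thesis
    using assms(2) by (simp add: cont_derivations_def)
qed

text \<open>Membership of the values in \<open>carrier A\<close> comes from continuity, since a
  continuous map takes its values in \<open>topspace TA\<close>.\<close>

lemma DerD:
  assumes "\<alpha> \<in> Der"
  shows "\<alpha> \<in> extensional (carrier G)" "continuous_map TG TA \<alpha>"
    "\<And>g. g \<in> carrier G \<Longrightarrow> \<alpha> g \<in> carrier A"
    "\<And>g h. g \<in> carrier G \<Longrightarrow> h \<in> carrier G \<Longrightarrow> \<alpha> (g \<otimes>\<^bsub>G\<^esub> h) = \<alpha> g \<otimes>\<^bsub>A\<^esub> act g (\<alpha> h)"
  using assms A.continuous_map_closed[of TG \<alpha>] G.topspace_eq by (auto simp: cont_derivations_def)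

lemma trivial_map_in_Der: "trivial_map G A \<in> Der"
  unfolding trivial_map_def
  by (rule restrict_in_DerI) (simp_all add: act_one_right A.topspace_eq)

text \<open>Putting \<open>g = h = \<one>\<close> in the derivation identity and cancelling shows
  that the unit of \<open>G\<close> sends \<open>\<alpha> \<one>\<close> to \<open>\<one>\<close>;
  but that unit acts as the identity.\<close>

lemma derivation_one:
  assumes "\<alpha> \<in> Der"
  shows "\<alpha> \<one>\<^bsub>G\<^esub> = \<one>\<^bsub>A\<^esub>"
proof -
  have *: "\<alpha> \<one>\<^bsub>G\<^esub> \<in> carrier A" "act \<one>\<^bsub>G\<^esub> (\<alpha> \<one>\<^bsub>G\<^esub>) \<in> carrier A"
    using DerD(3)[OF assms] act_closed by auto
  then have "act \<one>\<^bsub>G\<^esub> (\<alpha> \<one>\<^bsub>G\<^esub>) = \<one>\<^bsub>A\<^esub>"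
    using DerD(4)[OF assms, of "\<one>\<^bsub>G\<^esub>" "\<one>\<^bsub>G\<^esub>"] by (simp add: A.r_cancel_one')
  moreover have "act \<one>\<^bsub>G\<^esub> (\<alpha> \<one>\<^bsub>G\<^esub>) = \<alpha> \<one>\<^bsub>G\<^esub>"
    using hom_one[OF act_hom G.is_group A.AutoGroup] *(1)
    by (simp add: AutoGroup_def BijGroup_def)
  ultimately show ?thesis by simp
qed

text \<open>The defining formula is a right action of \<open>A\<close> by twisted conjugation, so
  the witnesses for reflexivity, symmetry and transitivity are the unit, the inverse of
  \<open>a\<close>, and the product of \<open>a\<close> and \<open>b\<close>.\<close>

lemma equiv_cohomologous: "equiv Der Coh"
proof (rule equivI)
  show "Coh \<subseteq> Der \<times> Der"
    by (auto simp: cohomologous_def)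
  show "refl_on Der Coh"
  proof (rule refl_onI)
    fix \<alpha> assume "\<alpha> \<in> Der"
    then show "(\<alpha>, \<alpha>) \<in> Coh"
      by (auto simp: cohomologous_def act_one_right DerD(3) intro!: bexI[of _ "\<one>\<^bsub>A\<^esub>"])
  qed
  show "sym Coh"
  proof (rule symI)
    fix \<alpha> \<beta> assume "(\<alpha>, \<beta>) \<in> Coh"
    then obtain a where a: "\<alpha> \<in> Der" "\<beta> \<in> Der" "a \<in> carrier A"
      "\<And>g. g \<in> carrier G \<Longrightarrow> \<beta> g = inv\<^bsub>A\<^esub> a \<otimes>\<^bsub>A\<^esub> \<alpha> g \<otimes>\<^bsub>A\<^esub> act g a"
      by (auto simp: cohomologous_def)
    then have "\<alpha> g = inv\<^bsub>A\<^esub> (inv\<^bsub>A\<^esub> a) \<otimes>\<^bsub>A\<^esub> \<beta> g \<otimes>\<^bsub>A\<^esub> act g (inv\<^bsub>A\<^esub> a)" if "g \<in> carrier G" for g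
      using that DerD(3)[OF a(1) that]
      by (simp add: act_inv act_closed A.m_assoc A.mult_inv_cancel_left)
    then show "(\<beta>, \<alpha>) \<in> Coh"
      using a(1-3) by (auto simp: cohomologous_def intro!: bexI[of _ "inv\<^bsub>A\<^esub> a"])
  qed
  show "trans Coh"
  proof (rule transI)
    fix \<alpha> \<beta> \<gamma> assume "(\<alpha>, \<beta>) \<in> Coh" "(\<beta>, \<gamma>) \<in> Coh"
    then obtain a b where ab: "\<alpha> \<in> Der" "\<gamma> \<in> Der" "a \<in> carrier A" "b \<in> carrier A"
      "\<And>g. g \<in> carrier G \<Longrightarrow> \<beta> g = inv\<^bsub>A\<^esub> a \<otimes>\<^bsub>A\<^esub> \<alpha> g \<otimes>\<^bsub>A\<^esub> act g a"
      "\<And>g. g \<in> carrier G \<Longrightarrow> \<gamma> g = inv\<^bsub>A\<^esub> b \<otimes>\<^bsub>A\<^esub> \<beta> g \<otimes>\<^bsub>A\<^esub> act g b"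
      by (auto simp: cohomologous_def)
    then have "\<gamma> g = inv\<^bsub>A\<^esub> (a \<otimes>\<^bsub>A\<^esub> b) \<otimes>\<^bsub>A\<^esub> \<alpha> g \<otimes>\<^bsub>A\<^esub> act g (a \<otimes>\<^bsub>A\<^esub> b)" if "g \<in> carrier G" for g
      using that DerD(3)[OF ab(1) that]
      by (simp add: act_mult act_closed A.m_assoc A.inv_mult_group)
    then show "(\<alpha>, \<gamma>) \<in> Coh"
      using ab(1-4) by (auto simp: cohomologous_def intro!: bexI[of _ "a \<otimes>\<^bsub>A\<^esub> b"])
  qed
qed

section \<open>Trivial action: derivations are homomorphisms\<close>

lemma cont_derivations_trivial_action:
  assumes "trivial_action G A act"
  shows "Der = Hom_c G TG A TA"
proof -
  have closed: "\<alpha> g \<in> carrier A" if "continuous_map TG TA \<alpha>" "g \<in> carrier G" for \<alpha> g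
    using A.continuous_map_closed[OF that(1)] that(2) G.topspace_eq by simp
  then show ?thesis
    using assms
    by (auto simp: trivial_action_def cont_derivations_def Hom_c_def hom_def Pi_iff)
qed

lemma cohomologous_trivial_action:
  assumes "trivial_action G A act"
  shows "Coh = conjugate_homs G TG A TA"
proof -
  \<comment> \<open>The action fixes \<open>a\<close> only for \<open>g\<close> and \<open>a\<close>
    in the carriers, so this is a conditional rewrite; \<open>bex_cong\<close> and
    \<open>ball_cong\<close> supply the two memberships.\<close>
  have "(\<beta> g = inv\<^bsub>A\<^esub> a \<otimes>\<^bsub>A\<^esub> \<alpha> g \<otimes>\<^bsub>A\<^esub> act g a) = (\<beta> g = inv\<^bsub>A\<^esub> a \<otimes>\<^bsub>A\<^esub> \<alpha> g \<otimes>\<^bsub>A\<^esub> a)"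
    if "g \<in> carrier G" "a \<in> carrier A" for \<alpha> \<beta> and g a
    using assms that by (simp add: trivial_action_def)
  then show ?thesis
    unfolding cohomologous_def conjugate_homs_def cont_derivations_trivial_action[OF assms]
    by (simp cong: bex_cong ball_cong)
qed

section \<open>Connected group, totally disconnected coefficients\<close>

text \<open>The set of derivations itself collapses, not only its quotient, so no element of
  \<open>A\<close> has to be found to witness cohomology.\<close>

lemma cont_derivations_connected:
  assumes "connected_space TG" "totally_disconnected_space TA"
  shows "Der = {trivial_map G A}"
proof -
  have eq: "\<alpha> = trivial_map G A" if "\<alpha> \<in> Der" for \<alpha>
  proof (rule extensionalityI[OF DerD(1)[OF that]])
    show "trivial_map G A \<in> extensional (carrier G)"
      by (simp add: trivial_map_def)
    fix g assume g: "g \<in> carrier G"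
    have "connectedin TA (\<alpha> ` carrier G)"
      using assms(1) G.topspace_eq
      by (intro connectedin_continuous_map_image[OF DerD(2)[OF that]])
        (simp flip: connectedin_topspace)
    moreover have 1: "\<one>\<^bsub>A\<^esub> \<in> \<alpha> ` carrier G"
      by (rule image_eqI[where f = \<alpha>, OF derivation_one[OF that, symmetric] G.one_closed])
    ultimately have sub: "\<alpha> ` carrier G \<subseteq> connected_component_of_set TA \<one>\<^bsub>A\<^esub>"
      by (rule connected_component_of_maximal)
    \<comment> \<open>Total disconnectedness speaks about members of
      \<open>connected_components_of TA\<close>; the component of the unit is one of them because
      the unit is a point of the space.\<close>
    have "connected_component_of_set TA \<one>\<^bsub>A\<^esub> \<in> connected_components_of TA"
      by (simp add: connected_components_of_def A.topspace_eq)
    from bspec[OF assms(2)[unfolded totally_disconnected_space_def] this]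
    obtain x where "connected_component_of_set TA \<one>\<^bsub>A\<^esub> = {x}"
      by (rule exE)
    then have "\<alpha> g = x" "\<one>\<^bsub>A\<^esub> = x"
      using subsetD[OF sub] 1 imageI[OF g, of \<alpha>] by auto
    then have "\<alpha> g = \<one>\<^bsub>A\<^esub>"
      by simp
    then show "\<alpha> g = trivial_map G A g"
      using g by (simp add: trivial_map_def)
  qed
  show ?thesis
  proof (intro equalityI subsetI)
    fix \<alpha> assume "\<alpha> \<in> Der"
    from eq[OF this] show "\<alpha> \<in> {trivial_map G A}" by simp
  qed (simp add: trivial_map_in_Der)
qed

text \<open>Hu's coboundaries and the inner derivations are one set; its form as an image makes
  facts about homomorphisms applicable.\<close>

lemma Hu_delta0_image: "Hu_delta0 G A act ` carrier A = inner_derivations G A act"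
  unfolding Hu_delta0_def inner_derivations_def by blast

end

section \<open>Abelian coefficients: Hu's group and cohomology classes as cosets\<close>

locale abelian_topological_module = topological_module + A: comm_group A
begin

abbreviation "DerG \<equiv> derivation_group G TG A TA act"

lemma derivation_group_simps:
  "carrier DerG = Der"
  "\<alpha> \<otimes>\<^bsub>DerG\<^esub> \<beta> = (\<lambda>g \<in> carrier G. \<alpha> g \<otimes>\<^bsub>A\<^esub> \<beta> g)"
  "\<one>\<^bsub>DerG\<^esub> = trivial_map G A"
  by (simp_all add: derivation_group_def cont_maps_def trivial_map_def G.topspace_eq)

text \<open>Commutativity of \<open>A\<close> is what closes \<open>Der\<close> under the pointwise
  operations: it regroups the four factors of a product at \<open>g h\<close>, and it lets inversion
  preserve the order of factors.\<close>

lemma comm_group_derivation_group: "comm_group DerG"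
proof (rule comm_groupI; unfold derivation_group_simps)
  fix \<alpha> \<beta> assume "\<alpha> \<in> Der" "\<beta> \<in> Der"
  note D = DerD[OF this(1)] DerD[OF this(2)]
  show "(\<lambda>g \<in> carrier G. \<alpha> g \<otimes>\<^bsub>A\<^esub> \<beta> g) \<in> Der"
    by (intro restrict_in_DerI A.continuous_map_mult D)
      (simp_all add: D act_mult act_closed A.m_ac)
  show "(\<lambda>g \<in> carrier G. \<alpha> g \<otimes>\<^bsub>A\<^esub> \<beta> g) = (\<lambda>g \<in> carrier G. \<beta> g \<otimes>\<^bsub>A\<^esub> \<alpha> g)"
    by (intro restrict_ext) (simp add: D A.m_comm)
next
  fix \<alpha> \<beta> \<gamma> assume "\<alpha> \<in> Der" "\<beta> \<in> Der" "\<gamma> \<in> Der"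
  note D = DerD(3)[OF this(1)] DerD(3)[OF this(2)] DerD(3)[OF this(3)]
  show "(\<lambda>g \<in> carrier G. (\<lambda>g \<in> carrier G. \<alpha> g \<otimes>\<^bsub>A\<^esub> \<beta> g) g \<otimes>\<^bsub>A\<^esub> \<gamma> g)
      = (\<lambda>g \<in> carrier G. \<alpha> g \<otimes>\<^bsub>A\<^esub> (\<lambda>g \<in> carrier G. \<beta> g \<otimes>\<^bsub>A\<^esub> \<gamma> g) g)"
    by (intro restrict_ext) (simp add: D A.m_assoc)
next
  show "trivial_map G A \<in> Der"
    by (rule trivial_map_in_Der)
next
  fix \<alpha> assume "\<alpha> \<in> Der"
  note D = DerD[OF this]
  show "(\<lambda>g \<in> carrier G. trivial_map G A g \<otimes>\<^bsub>A\<^esub> \<alpha> g) = \<alpha>"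
    by (intro extensionalityI[of _ "carrier G"]) (simp_all add: D trivial_map_def)
  have "(\<lambda>g \<in> carrier G. inv\<^bsub>A\<^esub> (\<alpha> g)) \<in> Der"
    by (intro restrict_in_DerI A.continuous_map_inv D)
      (simp_all add: D act_inv act_closed A.inv_mult)
  moreover have "(\<lambda>g \<in> carrier G. (\<lambda>g \<in> carrier G. inv\<^bsub>A\<^esub> (\<alpha> g)) g \<otimes>\<^bsub>A\<^esub> \<alpha> g) = trivial_map G A"
    unfolding trivial_map_def by (intro restrict_ext) (simp add: D)
  ultimately show "\<exists>\<beta> \<in> Der. (\<lambda>g \<in> carrier G. \<beta> g \<otimes>\<^bsub>A\<^esub> \<alpha> g) = trivial_map G A"
    by (intro bexI)
qed

text \<open>Additively, \<open>g(ha - a) = gha - ga\<close>, so \<open>(ga - a) + g(ha - a)\<close>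
  telescopes to \<open>gha - a\<close>; hence coboundaries are derivations. Additivity in
  \<open>a\<close> holds because each \<open>act g\<close> is a homomorphism and \<open>A\<close> is
  commutative.\<close>

lemma Hu_delta0_hom: "Hu_delta0 G A act \<in> hom A DerG"
proof (rule homI; unfold derivation_group_simps)
  fix a assume a: "a \<in> carrier A"
  show "Hu_delta0 G A act a \<in> Der"
    unfolding Hu_delta0_def
  proof (rule restrict_in_DerI)
    show "continuous_map TG TA (\<lambda>g. act g a \<otimes>\<^bsub>A\<^esub> inv\<^bsub>A\<^esub> a)"
      using a by (simp add: A.continuous_map_mult continuous_map_act A.topspace_eq)
    fix g h assume gh: "g \<in> carrier G" "h \<in> carrier G"
    then have c: "act g a \<in> carrier A" "act g (act h a) \<in> carrier A"
      using a by (simp_all add: act_closed)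
    \<comment> \<open>The factors are ordered so that \<open>act g a\<close> stands directly before
      its inverse and cancels in the next step.\<close>
    have "act g a \<otimes>\<^bsub>A\<^esub> inv\<^bsub>A\<^esub> a \<otimes>\<^bsub>A\<^esub> act g (act h a \<otimes>\<^bsub>A\<^esub> inv\<^bsub>A\<^esub> a)
        = inv\<^bsub>A\<^esub> a \<otimes>\<^bsub>A\<^esub> act g a \<otimes>\<^bsub>A\<^esub> (inv\<^bsub>A\<^esub> (act g a) \<otimes>\<^bsub>A\<^esub> act g (act h a))"
      using a gh c by (simp add: act_mult act_inv act_closed A.m_comm)
    also have "\<dots> = act (g \<otimes>\<^bsub>G\<^esub> h) a \<otimes>\<^bsub>A\<^esub> inv\<^bsub>A\<^esub> a"
      using a gh c by (simp add: act_act A.m_assoc A.mult_inv_cancel_left A.m_comm)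
    finally show "act (g \<otimes>\<^bsub>G\<^esub> h) a \<otimes>\<^bsub>A\<^esub> inv\<^bsub>A\<^esub> a
        = act g a \<otimes>\<^bsub>A\<^esub> inv\<^bsub>A\<^esub> a \<otimes>\<^bsub>A\<^esub> act g (act h a \<otimes>\<^bsub>A\<^esub> inv\<^bsub>A\<^esub> a)"
      by (rule sym)
  qed
next
  fix a b assume "a \<in> carrier A" "b \<in> carrier A"
  then show "Hu_delta0 G A act (a \<otimes>\<^bsub>A\<^esub> b)
      = (\<lambda>g \<in> carrier G. Hu_delta0 G A act a g \<otimes>\<^bsub>A\<^esub> Hu_delta0 G A act b g)"
    unfolding Hu_delta0_def
    by (intro restrict_ext) (simp add: act_mult act_closed A.inv_mult A.m_ac)
qed

text \<open>The image of a group homomorphism is a subgroup, and \<open>Hu_delta0\<close> has the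
  inner derivations as its image.\<close>

lemma subgroup_inner_derivations: "subgroup (inner_derivations G A act) DerG"
proof -
  interpret group_hom A DerG "Hu_delta0 G A act"
    using Hu_delta0_hom comm_group_derivation_group
    by (simp add: group_hom_def group_hom_axioms_def A.group_axioms comm_group.axioms)
  show ?thesis
    using img_is_subgroup by (simp add: Hu_delta0_image)
qed

text \<open>Both sides consist of continuous extensional maps, so only the equations need comparing:
  by commutativity Hu's expression is \<open>f g\<close> times \<open>act g (f h)\<close> divided by
  the value of \<open>f\<close> at the product.\<close>

lemma kernel_Hu_delta1:
  "kernel (cont_maps TG A TA) (cont_maps (prod_topology TG TG) A TA) (Hu_delta1 G A act) = Der"
proof -
  have "Hu_delta1 G A act f = \<one>\<^bsub>cont_maps (prod_topology TG TG) A TA\<^esub> \<longleftrightarrow>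
      (\<forall>g \<in> carrier G. \<forall>h \<in> carrier G. f (g \<otimes>\<^bsub>G\<^esub> h) = f g \<otimes>\<^bsub>A\<^esub> act g (f h))"
    if "continuous_map TG TA f" for f
  proof -
    have f: "f g \<in> carrier A" if "g \<in> carrier G" for g
      using A.continuous_map_closed[OF \<open>continuous_map TG TA f\<close>] that G.topspace_eq by simp
    \<comment> \<open>Both functions are restricted to pairs in \<open>carrier G\<close>, so their
      equality is equality on those pairs.\<close>
    have "Hu_delta1 G A act f = \<one>\<^bsub>cont_maps (prod_topology TG TG) A TA\<^esub> \<longleftrightarrow>
      (\<forall>g \<in> carrier G. \<forall>h \<in> carrier G.
        act g (f h) \<otimes>\<^bsub>A\<^esub> inv\<^bsub>A\<^esub> (f (g \<otimes>\<^bsub>G\<^esub> h)) \<otimes>\<^bsub>A\<^esub> f g = \<one>\<^bsub>A\<^esub>)"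
      by (auto simp: Hu_delta1_def cont_maps_def G.topspace_eq fun_eq_iff restrict_def)
    moreover have "act g (f h) \<otimes>\<^bsub>A\<^esub> inv\<^bsub>A\<^esub> (f (g \<otimes>\<^bsub>G\<^esub> h)) \<otimes>\<^bsub>A\<^esub> f g = \<one>\<^bsub>A\<^esub> \<longleftrightarrow>
        f (g \<otimes>\<^bsub>G\<^esub> h) = f g \<otimes>\<^bsub>A\<^esub> act g (f h)"
      if gh: "g \<in> carrier G" "h \<in> carrier G" for g h
    proof -
      have c: "act g (f h) \<in> carrier A" "f g \<in> carrier A" "f (g \<otimes>\<^bsub>G\<^esub> h) \<in> carrier A"
        using gh f act_closed by auto
      then have "act g (f h) \<otimes>\<^bsub>A\<^esub> inv\<^bsub>A\<^esub> (f (g \<otimes>\<^bsub>G\<^esub> h)) \<otimes>\<^bsub>A\<^esub> f g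
          = f g \<otimes>\<^bsub>A\<^esub> act g (f h) \<otimes>\<^bsub>A\<^esub> inv\<^bsub>A\<^esub> (f (g \<otimes>\<^bsub>G\<^esub> h))"
        by (simp add: A.m_ac)
      then show ?thesis
        using c A.inv_solve_right'[of "\<one>\<^bsub>A\<^esub>" "f g \<otimes>\<^bsub>A\<^esub> act g (f h)" "f (g \<otimes>\<^bsub>G\<^esub> h)"]
        by auto
    qed
    ultimately show ?thesis by auto
  qed
  then show ?thesis
    by (auto simp: kernel_def cont_derivations_def cont_maps_def G.topspace_eq)
qed

lemma Hu_H1_eq: "Hu_H1 G TG A TA act = DerG Mod inner_derivations G A act"
  by (simp add: Hu_H1_def kernel_Hu_delta1 Hu_delta0_image derivation_group_def)

text \<open>An element \<open>a\<close> witnessing cohomology corresponds to the inner derivation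
  \<open>Hu_delta0 G A act a\<close> that translates \<open>\<alpha>\<close>, so class and coset are
  compared witness by witness.\<close>

lemma cohomologous_class:
  assumes "\<alpha> \<in> Der"
  shows "Coh `` {\<alpha>} = inner_derivations G A act #>\<^bsub>DerG\<^esub> \<alpha>"
proof -
  interpret D: comm_group DerG
    by (rule comm_group_derivation_group)
  have eq: "\<beta> = Hu_delta0 G A act a \<otimes>\<^bsub>DerG\<^esub> \<alpha> \<longleftrightarrow>
      (\<forall>g \<in> carrier G. \<beta> g = inv\<^bsub>A\<^esub> a \<otimes>\<^bsub>A\<^esub> \<alpha> g \<otimes>\<^bsub>A\<^esub> act g a)"
    if "\<beta> \<in> extensional (carrier G)" "a \<in> carrier A" for \<beta> a
  proof -
    have "\<beta> = Hu_delta0 G A act a \<otimes>\<^bsub>DerG\<^esub> \<alpha> \<longleftrightarrow>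
        (\<forall>g \<in> carrier G. \<beta> g = act g a \<otimes>\<^bsub>A\<^esub> inv\<^bsub>A\<^esub> a \<otimes>\<^bsub>A\<^esub> \<alpha> g)"
      using that(1) by (auto simp: derivation_group_simps Hu_delta0_def intro: extensionalityI)
    also have "\<dots> \<longleftrightarrow> (\<forall>g \<in> carrier G. \<beta> g = inv\<^bsub>A\<^esub> a \<otimes>\<^bsub>A\<^esub> \<alpha> g \<otimes>\<^bsub>A\<^esub> act g a)"
      using that(2) by (intro ball_cong refl) (simp add: DerD[OF assms] act_closed A.m_ac)
    finally show ?thesis .
  qed
  \<comment> \<open>The relation demands \<open>\<beta> \<in> Der\<close> explicitly while the coset
    does not; this recovers that membership when passing from coset to class.\<close>
  have closed: "Hu_delta0 G A act a \<otimes>\<^bsub>DerG\<^esub> \<alpha> \<in> Der" if "a \<in> carrier A" for a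
    using D.m_closed[OF hom_in_carrier[OF Hu_delta0_hom that]] assms
    by (simp only: derivation_group_simps(1))
  show ?thesis
  proof (rule Set.set_eqI)
    fix \<beta>
    have "\<beta> \<in> Coh `` {\<alpha>} \<longleftrightarrow> \<beta> \<in> Der \<and>
        (\<exists>a \<in> carrier A. \<forall>g \<in> carrier G. \<beta> g = inv\<^bsub>A\<^esub> a \<otimes>\<^bsub>A\<^esub> \<alpha> g \<otimes>\<^bsub>A\<^esub> act g a)"
      using assms by (simp add: cohomologous_def)
    also have "\<dots> \<longleftrightarrow> (\<exists>a \<in> carrier A. \<beta> = Hu_delta0 G A act a \<otimes>\<^bsub>DerG\<^esub> \<alpha>)"
      by (metis eq closed DerD(1))
    also have "\<dots> \<longleftrightarrow> \<beta> \<in> inner_derivations G A act #>\<^bsub>DerG\<^esub> \<alpha>"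
      unfolding r_coset_def Hu_delta0_image[symmetric] by blast
    finally show "\<beta> \<in> Coh `` {\<alpha>} \<longleftrightarrow> \<beta> \<in> inner_derivations G A act #>\<^bsub>DerG\<^esub> \<alpha>" .
  qed
qed

text \<open>Classes and cosets are both indexed by the derivations and agree term by term.\<close>

lemma H1_eq_cosets: "H1 G TG A TA act = rcosets\<^bsub>DerG\<^esub> inner_derivations G A act"
  by (auto simp: H1_def quotient_def RCOSETS_def derivation_group_simps(1) cohomologous_class)

text \<open>The trivial map is the unit of \<open>DerG\<close>, and the coset of the unit is the
  subgroup itself.\<close>

lemma H1_basepoint_eq: "H1_basepoint G TG A TA act = inner_derivations G A act"
proof -
  interpret D: comm_group DerG
    by (rule comm_group_derivation_group)
  show ?thesis
    using D.coset_mult_one[OF subgroup.subset[OF subgroup_inner_derivations]]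
    by (simp add: H1_basepoint_def cohomologous_class trivial_map_in_Der derivation_group_simps(3))
qed

end

text \<open>\<open>H1\<close> is a bare set and \<open>Hu_H1\<close> a group record, so the abelian
  case matches carrier and unit separately and then identifies the record with the quotient of the
  derivation group.\<close>

theorem mainTheorem2:
  fixes G :: "('g, 'm) monoid_scheme" and TG :: "'g topology"
    and A :: "('a, 'n) monoid_scheme" and TA :: "'a topology"
    and act :: "'g \<Rightarrow> 'a \<Rightarrow> 'a"
  assumes "topological_module G TG A TA act"
  shows
    "(comm_group A \<longrightarrow>
        comm_group (Hu_H1 G TG A TA act) \<and>
        H1 G TG A TA act = carrier (Hu_H1 G TG A TA act) \<and>
        H1_basepoint G TG A TA act = \<one>\<^bsub>Hu_H1 G TG A TA act\<^esub> \<and>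
        inner_derivations G A act \<lhd> derivation_group G TG A TA act \<and>
        Hu_H1 G TG A TA act = derivation_group G TG A TA act Mod inner_derivations G A act) \<and>
     (trivial_action G A act \<longrightarrow>
        equiv (Hom_c G TG A TA) (conjugate_homs G TG A TA) \<and>
        H1 G TG A TA act = Hom_c G TG A TA // conjugate_homs G TG A TA \<and>
        H1_basepoint G TG A TA act = conjugate_homs G TG A TA `` {trivial_map G A}) \<and>
     (connected_space TG \<and> totally_disconnected_space TA \<longrightarrow>
        H1 G TG A TA act = {H1_basepoint G TG A TA act})"
proof -
  interpret topological_module G TG A TA act by (rule assms)
  show ?thesis
  proof (rule conjI[OF _ conjI]; rule impI)
    assume "comm_group A"
    then interpret abelian_topological_module G TG A TA act
      by (simp add: abelian_topological_module_def assms)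
    note D = comm_group_derivation_group and I = subgroup_inner_derivations
    show "comm_group (Hu_H1 G TG A TA act) \<and>
        H1 G TG A TA act = carrier (Hu_H1 G TG A TA act) \<and>
        H1_basepoint G TG A TA act = \<one>\<^bsub>Hu_H1 G TG A TA act\<^esub> \<and>
        inner_derivations G A act \<lhd> derivation_group G TG A TA act \<and>
        Hu_H1 G TG A TA act = derivation_group G TG A TA act Mod inner_derivations G A act"
      \<comment> \<open>A factor group has the cosets as carrier and the subgroup as unit, which are
        \<open>H1\<close> and its basepoint by the two preceding identifications.\<close>
      using comm_group.abelian_FactGroup[OF D I] comm_group.subgroup_imp_normal[OF D I]
      by (simp add: Hu_H1_eq H1_eq_cosets H1_basepoint_eq FactGroup_def)
  next
    assume triv: "trivial_action G A act"
    note eqs = cont_derivations_trivial_action[OF triv] cohomologous_trivial_action[OF triv]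
    show "equiv (Hom_c G TG A TA) (conjugate_homs G TG A TA) \<and>
        H1 G TG A TA act = Hom_c G TG A TA // conjugate_homs G TG A TA \<and>
        H1_basepoint G TG A TA act = conjugate_homs G TG A TA `` {trivial_map G A}"
      using equiv_cohomologous by (simp add: H1_def H1_basepoint_def eqs)
  next
    assume "connected_space TG \<and> totally_disconnected_space TA"
    then have "Der = {trivial_map G A}" by (elim conjE) (rule cont_derivations_connected)
    \<comment> \<open>The quotient of a one-point set contains only the class of that point, here
      the basepoint.\<close>
    then show "H1 G TG A TA act = {H1_basepoint G TG A TA act}"
      by (simp add: H1_def H1_basepoint_def quotient_def)
  qed
qed

end
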